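(* For $n\ge1$ let $Q_n$ be a uniformly random Stirling permutation of length $2n$, and let $X_n$, $Y_n$, $Z_n$ denote respectively the numbers of ascents, descents and plateaux of $Q_n$. Then for every $n\ge 1$, \[ \operatorname{Cov}(X_n,Y_n)=\operatorname{Cov}(X_n,Z_n)=\operatorname{Cov}(Y_n,Z_n)=-\frac{n^2-1}{9(2n-1)}. \]
   Context: A Stirling permutation of length $2n$ is a permutation (word) $a_1a_2\cdots a_{2n}$ of the multiset $\{1,1,2,2,\dots,n,n\}$ such that for each $i\le n$, all elements occurring between the two occurrences of $i$ are larger than $i$. A uniformly random Stirling permutation is a uniformly random element of the finite set of all Stirling permutations of length $2n$. Set $a_0=a_{2n+1}=0$. An index $i\in\{0,1,\dots,2n\}$ is an ascent if $a_i<a_{i+1}$, a descent if $a_i>a_{i+1}$, and a plateau if $a_i=a_{i+1}$. *)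

theory Defs
  imports
    "HOL-Probability.Probability"
    "HOL-Combinatorics.Multiset_Permutations"
begin

definition stirling_permutations :: "nat \<Rightarrow> nat list set" where
  "stirling_permutations n =
     {w \<in> permutations_of_multiset (mset_set {1..n} + mset_set {1..n}).
        \<forall>j k l. j < k \<and> k < l \<and> l < length w \<and> w ! j = w ! l \<longrightarrow> w ! j < w ! k}"

text \<open>Letters \<open>a\<^sub>0, a\<^sub>1, \<dots>, a\<^sub>m, a\<^sub>m\<^sub>+\<^sub>1\<close> of a word \<open>a\<^sub>1 \<dots> a\<^sub>m\<close>, with the convention \<open>a\<^sub>0 = a\<^sub>m\<^sub>+\<^sub>1 = 0\<close>.\<close>

definition letter :: "nat list \<Rightarrow> nat \<Rightarrow> nat" where
  "letter w i = (0 # w @ [0]) ! i"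

definition num_ascents :: "nat list \<Rightarrow> nat" where
  "num_ascents w = card {i \<in> {0..length w}. letter w i < letter w (i + 1)}"

definition num_descents :: "nat list \<Rightarrow> nat" where
  "num_descents w = card {i \<in> {0..length w}. letter w i > letter w (i + 1)}"

definition num_plateaux :: "nat list \<Rightarrow> nat" where
  "num_plateaux w = card {i \<in> {0..length w}. letter w i = letter w (i + 1)}"

definition random_stirling :: "nat \<Rightarrow> nat list pmf" where
  "random_stirling n = pmf_of_set (stirling_permutations n)"

definition covariance :: "'a measure \<Rightarrow> ('a \<Rightarrow> real) \<Rightarrow> ('a \<Rightarrow> real) \<Rightarrow> real" where
  "covariance M X Y =
     integral\<^sup>L M (\<lambda>x. (X x - integral\<^sup>L M X) * (Y x - integral\<^sup>L M Y))"

text \<open>\<^const>\<open>pmf_of_set\<close> is the uniform distribution only on finite nonempty sets.\<close>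

lemma finite_stirling_permutations: "finite (stirling_permutations n)"
  unfolding stirling_permutations_def by simp

lemma length_stirling_permutation: "w \<in> stirling_permutations n \<Longrightarrow> length w = 2 * n"
  by (auto simp: stirling_permutations_def permutations_of_multiset_def
           simp flip: size_mset)

lemma stirling_permutations_nonempty: "stirling_permutations n \<noteq> {}"
proof -
  have "\<exists>w. w \<in> stirling_permutations n"
  proof (induction n)
    case 0
    show ?case
      by (auto simp: stirling_permutations_def permutations_of_multiset_def)
  next
    case (Suc n)
    then obtain w where w: "w \<in> stirling_permutations n" by blast
    have m: "mset w = mset_set {1..n} + mset_set {1..n}"
      using w by (simp add: stirling_permutations_def permutations_of_multiset_def)
    have "set w = {1..n}"
      by (metis m finite_atLeastAtMost finite_set_mset_mset_set set_mset_mset set_mset_union sup.idem)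
    then have small: "w ! i \<noteq> Suc n" if "i < length w" for i
      using nth_mem[OF that] by auto
    have "{1..Suc n} = insert (Suc n) {1..n}" by auto
    then have m': "mset (w @ [Suc n, Suc n]) = mset_set {1..Suc n} + mset_set {1..Suc n}"
      using m by simp
    have "(w @ [Suc n, Suc n]) ! j < (w @ [Suc n, Suc n]) ! k"
      if "j < k" "k < l" "l < length (w @ [Suc n, Suc n])"
        "(w @ [Suc n, Suc n]) ! j = (w @ [Suc n, Suc n]) ! l" for j k l
    proof (cases "l < length w")
      case True
      then show ?thesis
        using that w by (auto simp: stirling_permutations_def nth_append)
    next
      case False
      then have "l = length w \<or> l = Suc (length w)" using that by auto
      moreover have "j < length w" using that by auto
      ultimately show ?thesis
        using that small[of j] by (auto simp: nth_append)
    qed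
    then have "w @ [Suc n, Suc n] \<in> stirling_permutations (Suc n)"
      using m' unfolding stirling_permutations_def permutations_of_multiset_def by blast
    then show ?case by blast
  qed
  then show ?thesis by blast
qed

end

theory Submission
  imports Defs
begin

text \<open>
  Since nothing exceeds \<open>n + 1\<close>, its two copies are adjacent in every Stirling permutation of
  length \<open>2(n + 1)\<close>, so these words arise uniquely from Stirling permutations of length \<open>2n\<close> by
  inserting the block \<open>(n+1)(n+1)\<close> into one of the \<open>2n + 1\<close> gaps.  The insertion destroys the
  chosen gap and creates exactly one ascent, one plateau and one descent.  Averaging over the
  gap gives linear recurrences for the first and mixed second moments which are the same
  for all three statistics, and the closed forms follow by induction.
\<close>

section \<open>Inserting the two largest letters\<close>

definition insert_twice :: "'a \<Rightarrow> nat \<Rightarrow> 'a list \<Rightarrow> 'a list" where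
  "insert_twice x i w = take i w @ [x, x] @ drop i w"

lemma set_stirling_permutation:
  assumes "w \<in> stirling_permutations n"
  shows "set w = {1..n}"
proof -
  have "mset w = mset_set {1..n} + mset_set {1..n}"
    using assms by (simp add: stirling_permutations_def permutations_of_multiset_def)
  then have "set_mset (mset w) = {1..n}" by simp
  then show ?thesis by simp
qed

lemma mset_set_Suc_twice:
  "mset_set {1..Suc n} + mset_set {1..Suc n} = mset_set {1..n} + mset_set {1..n} + {#Suc n, Suc n#}"
proof -
  have "{1..Suc n} = insert (Suc n) {1..n}" by auto
  then show ?thesis by simp
qed

text \<open>The two new letters are adjacent, so equal letters with something between them are old
  letters; a letter between them is either old or the new maximum.\<close>

lemma insert_twice_stirling:
  assumes "u @ v \<in> stirling_permutations n"
  shows "u @ [Suc n, Suc n] @ v \<in> stirling_permutations (Suc n)"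
proof -
  let ?N = "Suc n" and ?w = "u @ [Suc n, Suc n] @ v"
  \<comment> \<open>\<open>?g\<close> sends a position outside the inserted block to its position in
    \<open>u @ v\<close>. It is strictly increasing there; its values on the block itself are never
    read.\<close>
  let ?g = "\<lambda>i. if i < length u then i else i - 2"
  have m: "mset (u @ v) = mset_set {1..n} + mset_set {1..n}"
    using assms by (simp add: stirling_permutations_def permutations_of_multiset_def)
  have m': "mset ?w = mset_set {1..?N} + mset_set {1..?N}"
    unfolding mset_set_Suc_twice m[symmetric] by simp
  have small: "(u @ v) ! i < ?N" if "i < length (u @ v)" for i
    using nth_mem[OF that] unfolding set_stirling_permutation[OF assms] by simp
  have nth_w: "?w ! i = (if i = length u \<or> i = Suc (length u) then ?N else (u @ v) ! ?g i)" for i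
    by (auto simp: nth_append nth_Cons' numeral_2_eq_2)
  have old: "(u @ v) ! i < (u @ v) ! k"
    if "i < k" "k < l" "l < length (u @ v)" "(u @ v) ! i = (u @ v) ! l" for i k l
    using assms that unfolding stirling_permutations_def by blast
  have "?w ! j < ?w ! k" if h: "j < k" "k < l" "l < length ?w" "?w ! j = ?w ! l" for j k l
  proof -
    have mid: "?w ! i = ?N \<longleftrightarrow> i = length u \<or> i = Suc (length u)" if "i < length ?w" for i
    proof (cases "i = length u \<or> i = Suc (length u)")
      case True
      then show ?thesis unfolding nth_w by simp
    next
      case False
      then have "?g i < length (u @ v)" using that by auto
      then show ?thesis using small[of "?g i"] False unfolding nth_w by simp
    qed
    have jl: "?w ! j \<noteq> ?N"
      using h mid[of j] mid[of l] by auto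
    then have j: "\<not> (j = length u \<or> j = Suc (length u))" and l: "\<not> (l = length u \<or> l = Suc (length u))"
      using h mid[of j] mid[of l] by auto
    have gj: "?g j < length (u @ v)" using h j by auto
    show ?thesis
    proof (cases "k = length u \<or> k = Suc (length u)")
      case True
      then show ?thesis using small[OF gj] j unfolding nth_w by simp
    next
      case False
      have "(u @ v) ! ?g j < (u @ v) ! ?g k"
      proof (rule old)
        show "?g j < ?g k" "?g k < ?g l" "?g l < length (u @ v)"
          using h j l False by auto
        show "(u @ v) ! ?g j = (u @ v) ! ?g l"
          using h(4) j l unfolding nth_w by simp
      qed
      then show ?thesis using j False unfolding nth_w by simp
    qed
  qed
  then show ?thesis
    using m' unfolding stirling_permutations_def permutations_of_multiset_def by blast
qed

text \<open>The Stirling condition passes to subwords: \<open>?f\<close> below is the increasing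
  embedding of the positions of \<open>u @ v\<close> into the longer word.\<close>

lemma remove_twice_stirling:
  assumes "u @ [Suc n, Suc n] @ v \<in> stirling_permutations (Suc n)"
  shows "u @ v \<in> stirling_permutations n"
proof -
  let ?N = "Suc n" and ?w = "u @ [Suc n, Suc n] @ v"
  let ?f = "\<lambda>i. if i < length u then i else i + 2"
  have "mset ?w = mset_set {1..?N} + mset_set {1..?N}"
    using assms by (simp add: stirling_permutations_def permutations_of_multiset_def)
  then have m: "mset (u @ v) = mset_set {1..n} + mset_set {1..n}"
    unfolding mset_set_Suc_twice by simp
  have nth_uv: "(u @ v) ! i = ?w ! ?f i" for i
    by (auto simp: nth_append)
  have old: "?w ! i < ?w ! k"
    if "i < k" "k < l" "l < length ?w" "?w ! i = ?w ! l" for i k l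
    using assms that unfolding stirling_permutations_def by blast
  have "(u @ v) ! j < (u @ v) ! k"
    if h: "j < k" "k < l" "l < length (u @ v)" "(u @ v) ! j = (u @ v) ! l" for j k l
    unfolding nth_uv
  proof (rule old)
    show "?f j < ?f k" "?f k < ?f l" "?f l < length ?w"
      using h by auto
    show "?w ! ?f j = ?w ! ?f l"
      using h(4) unfolding nth_uv .
  qed
  then show ?thesis
    using m unfolding stirling_permutations_def permutations_of_multiset_def by blast
qed

text \<open>A letter between the two copies of \<open>Suc n\<close> would have to exceed the largest
  letter.\<close>

lemma stirling_Suc_split:
  assumes w: "w \<in> stirling_permutations (Suc n)"
  obtains u v where "w = u @ [Suc n, Suc n] @ v"
proof -
  let ?N = "Suc n"
  have m: "mset w = mset_set {1..n} + mset_set {1..n} + {#?N, ?N#}"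
    using w unfolding mset_set_Suc_twice[symmetric]
    by (simp add: stirling_permutations_def permutations_of_multiset_def)
  then have "?N \<in># mset w" by simp
  then obtain u t where ut: "w = u @ ?N # t" by (auto dest: split_list)
  \<comment> \<open>Cancelling one copy of \<open>?N\<close> from the multiset leaves the second,
    which lies on one side of the first.\<close>
  have "?N \<in> set u \<or> ?N \<in> set t"
  proof -
    have "add_mset ?N (mset u + mset t) = add_mset ?N (add_mset ?N (mset_set {1..n} + mset_set {1..n}))"
      using m ut by simp
    then have "mset u + mset t = add_mset ?N (mset_set {1..n} + mset_set {1..n})"
      by (simp only: add_mset_add_mset_same_iff)
    then have "?N \<in># mset u + mset t" by simp
    then show ?thesis by auto
  qed
  then obtain a b c where abc: "w = a @ ?N # b @ ?N # c"
    using ut by (metis append.assoc append_Cons split_list)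
  have "b = []"
  proof (rule ccontr)
    assume b: "b \<noteq> []"
    let ?j = "length a" and ?k = "Suc (length a)" and ?l = "Suc (length a + length b)"
    have "w ! ?j < w ! ?k"
    proof -
      have "?j < ?k" "?k < ?l" "?l < length w" "w ! ?j = w ! ?l"
        using b by (auto simp: abc nth_append)
      then show ?thesis using w unfolding stirling_permutations_def by blast
    qed
    moreover have "w ! ?k \<le> ?N"
      using nth_mem[of ?k w] set_stirling_permutation[OF w] by (auto simp: abc)
    ultimately show False by (simp add: abc nth_append)
  qed
  then show thesis using that abc by simp
qed

text \<open>Both coordinates can be read off the image: deleting \<open>Suc n\<close> returns the
  word, and the prefix before the first \<open>Suc n\<close> has length equal to the gap
  index.\<close>

lemma bij_betw_insert_twice:
  "bij_betw (\<lambda>(w, i). insert_twice (Suc n) i w)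
     (stirling_permutations n \<times> {..2 * n}) (stirling_permutations (Suc n))"
  unfolding bij_betw_def
proof
  let ?N = "Suc n"
  have fresh: "?N \<notin> set w" if "w \<in> stirling_permutations n" for w
    using set_stirling_permutation[OF that] by simp
  have w_eq: "filter (\<lambda>x. x \<noteq> ?N) (insert_twice ?N i w) = w" if "w \<in> stirling_permutations n" for w i
  proof -
    have "filter (\<lambda>x. x \<noteq> ?N) w = w"
      using fresh[OF that] by (auto intro: filter_True)
    moreover have "filter (\<lambda>x. x \<noteq> ?N) (insert_twice ?N i w) = filter (\<lambda>x. x \<noteq> ?N) (take i w @ drop i w)"
      unfolding insert_twice_def filter_append by simp
    ultimately show ?thesis by simp
  qed
  have i_eq: "length (takeWhile (\<lambda>x. x \<noteq> ?N) (insert_twice ?N i w)) = i"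
    if "w \<in> stirling_permutations n" "i \<le> 2 * n" for w i
  proof -
    have "takeWhile (\<lambda>x. x \<noteq> ?N) (insert_twice ?N i w) = take i w"
      unfolding insert_twice_def using fresh[OF that(1)]
      by (subst takeWhile_append2) (auto dest: in_set_takeD)
    then show ?thesis using that length_stirling_permutation[of w n] by simp
  qed
  show "inj_on (\<lambda>(w, i). insert_twice ?N i w) (stirling_permutations n \<times> {..2 * n})"
    by (rule inj_onI) (auto, metis w_eq, metis i_eq)
  show "(\<lambda>(w, i). insert_twice ?N i w) ` (stirling_permutations n \<times> {..2 * n})
          = stirling_permutations (Suc n)"
  proof (intro equalityI subsetI)
    fix w assume "w \<in> (\<lambda>(w, i). insert_twice ?N i w) ` (stirling_permutations n \<times> {..2 * n})"
    then show "w \<in> stirling_permutations (Suc n)"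
      using insert_twice_stirling[of "take i x" "drop i x" n for i x]
      by (auto simp: insert_twice_def)
  next
    fix w assume w: "w \<in> stirling_permutations (Suc n)"
    then obtain u v where uv: "w = u @ [?N, ?N] @ v" by (rule stirling_Suc_split)
    have "u @ v \<in> stirling_permutations n"
      using remove_twice_stirling w uv by blast
    moreover from this have "length u \<le> 2 * n"
      using length_stirling_permutation by fastforce
    moreover have "w = insert_twice ?N (length u) (u @ v)"
      by (simp add: uv insert_twice_def)
    ultimately show "w \<in> (\<lambda>(w, i). insert_twice ?N i w) ` (stirling_permutations n \<times> {..2 * n})"
      by (auto intro!: image_eqI[of _ _ "(u @ v, length u)"])
  qed
qed

section \<open>Uniform averages and their passage from n to n + 1\<close>

lemma card_stirling_permutations_Suc:
  "card (stirling_permutations (Suc n)) = card (stirling_permutations n) * (2 * n + 1)"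
  using bij_betw_same_card[OF bij_betw_insert_twice[of n]] by (simp add: card_cartesian_product)

lemma expectation_random_stirling:
  "measure_pmf.expectation (random_stirling n) (f :: _ \<Rightarrow> real)
     = (\<Sum>w\<in>stirling_permutations n. f w) / card (stirling_permutations n)"
  unfolding random_stirling_def
  by (rule integral_pmf_of_set) (simp_all add: finite_stirling_permutations stirling_permutations_nonempty)

lemma integrable_random_stirling [simp]:
  "integrable (measure_pmf (random_stirling n)) (f :: _ \<Rightarrow> real)"
  unfolding random_stirling_def
  by (rule integrable_measure_pmf_finite)
    (simp add: finite_stirling_permutations stirling_permutations_nonempty)

text \<open>A uniform word of the next size is a uniform word with the block inserted at an
  independent uniform gap among 2n + 1.\<close>

lemma expectation_random_stirling_Suc:
  "measure_pmf.expectation (random_stirling (Suc n)) (f :: _ \<Rightarrow> real)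
     = measure_pmf.expectation (random_stirling n) (\<lambda>w. \<Sum>i\<le>2 * n. f (insert_twice (Suc n) i w))
         / (2 * real n + 1)"
proof -
  have "(\<Sum>w\<in>stirling_permutations (Suc n). f w)
      = (\<Sum>(w, i)\<in>stirling_permutations n \<times> {..2 * n}. f (insert_twice (Suc n) i w))"
    by (subst sum.reindex_bij_betw[OF bij_betw_insert_twice, symmetric]) (simp add: case_prod_unfold)
  also have "\<dots> = (\<Sum>w\<in>stirling_permutations n. \<Sum>i\<le>2 * n. f (insert_twice (Suc n) i w))"
    by (simp add: sum.cartesian_product)
  finally show ?thesis
    by (simp add: expectation_random_stirling card_stirling_permutations_Suc algebra_simps)
qed

lemma expectation_random_stirling_cong:
  assumes "\<And>w. w \<in> stirling_permutations n \<Longrightarrow> f w = (g w :: real)"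
  shows "measure_pmf.expectation (random_stirling n) f = measure_pmf.expectation (random_stirling n) g"
  using assms by (simp add: expectation_random_stirling cong: sum.cong)

section \<open>Counting gaps\<close>

text \<open>Real-valued indicators, with the relation as a parameter, let one computation of moments
  serve all three statistics.\<close>

definition gap :: "(nat \<Rightarrow> nat \<Rightarrow> bool) \<Rightarrow> nat list \<Rightarrow> nat \<Rightarrow> real" where
  "gap R w i = of_bool (R (letter w i) (letter w (i + 1)))"

definition num_gaps :: "(nat \<Rightarrow> nat \<Rightarrow> bool) \<Rightarrow> nat list \<Rightarrow> real" where
  "num_gaps R w = (\<Sum>i\<le>length w. gap R w i)"

lemma card_gaps: "real (card {i \<in> {0..length w}. R (letter w i) (letter w (i + 1))}) = num_gaps R w"
  unfolding num_gaps_def gap_def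
  by (simp add: sum.If_cases of_bool_def Int_def atLeast0AtMost)

lemma num_ascents_eq: "real (num_ascents w) = num_gaps (<) w"
  and num_descents_eq: "real (num_descents w) = num_gaps (>) w"
  and num_plateaux_eq: "real (num_plateaux w) = num_gaps (=) w"
  unfolding num_ascents_def num_descents_def num_plateaux_def by (rule card_gaps)+

text \<open>The relations \<open><\<close>, \<open>>\<close> and \<open>=\<close> each hold for exactly one of the three new gaps
  \<open>(a, b)\<close>, \<open>(b, b)\<close>, \<open>(b, c)\<close> created by inserting \<open>b b\<close> between smaller letters \<open>a\<close> and \<open>c\<close>.\<close>

definition one_new_gap :: "(nat \<Rightarrow> nat \<Rightarrow> bool) \<Rightarrow> bool" where
  "one_new_gap R \<longleftrightarrow>
     (\<forall>a b c. a < b \<longrightarrow> c < b \<longrightarrow> of_bool (R a b) + of_bool (R b b) + of_bool (R b c) = (1::real))"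

lemma one_new_gap_simps: "one_new_gap (<)" "one_new_gap (>)" "one_new_gap (=)"
  unfolding one_new_gap_def by auto

text \<open>The left boundary letter \<open>a\<close> is arbitrary because in the induction the head
  of the word becomes the left boundary of its tail. The extra term on the left is the gap that the
  insertion destroys.\<close>

lemma sum_insert_twice:
  fixes h :: "'a \<Rightarrow> 'a \<Rightarrow> real"
  assumes "i \<le> length w"
  shows "(\<Sum>j\<le>length w + 2. h ((a # insert_twice b i w @ [z]) ! j) ((insert_twice b i w @ [z]) ! j))
           + h ((a # w @ [z]) ! i) ((w @ [z]) ! i)
         = (\<Sum>j\<le>length w. h ((a # w @ [z]) ! j) ((w @ [z]) ! j))
           + h ((a # w @ [z]) ! i) b + h b b + h b ((w @ [z]) ! i)"
  using assms
proof (induction w arbitrary: a i)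
  case Nil
  then show ?case by (simp add: insert_twice_def numeral_2_eq_2)
next
  case (Cons x w)
  show ?case
  proof (cases i)
    case 0
    then show ?thesis by (simp add: insert_twice_def sum.atMost_Suc_shift del: sum.atMost_Suc)
  next
    case (Suc k)
    have ins: "insert_twice b (Suc k) (x # w) = x # insert_twice b k w"
      by (simp add: insert_twice_def)
    show ?thesis
      using Cons.IH[of k x] Cons.prems Suc
      by (simp add: ins sum.atMost_Suc_shift del: sum.atMost_Suc)
  qed
qed

lemma num_gaps_insert_twice:
  assumes R: "one_new_gap R" and w: "w \<in> stirling_permutations n" and i: "i \<le> 2 * n"
  shows "num_gaps R (insert_twice (Suc n) i w) = num_gaps R w + 1 - gap R w i"
proof -
  have len: "length w = 2 * n" using w by (rule length_stirling_permutation)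
  have len': "length (insert_twice (Suc n) i w) = length w + 2"
    using i len by (simp add: insert_twice_def)
  \<comment> \<open>The bound includes the boundary zeros, so the end gaps also lie between letters
    smaller than the inserted one.\<close>
  have "letter w j < Suc n" if "j \<le> Suc (length w)" for j
  proof -
    have "letter w j \<in> set (0 # w @ [0])"
      unfolding letter_def using that by (intro nth_mem) simp
    then show ?thesis using set_stirling_permutation[OF w] by auto
  qed
  then have "letter w i < Suc n" "letter w (i + 1) < Suc n" using i len by auto
  then have new: "of_bool (R (letter w i) (Suc n)) + of_bool (R (Suc n) (Suc n))
      + of_bool (R (Suc n) (letter w (i + 1))) = (1::real)"
    using R unfolding one_new_gap_def by blast
  have "num_gaps R (insert_twice (Suc n) i w) + gap R w i
      = num_gaps R w + of_bool (R (letter w i) (Suc n)) + of_bool (R (Suc n) (Suc n))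
        + of_bool (R (Suc n) (letter w (i + 1)))"
    using sum_insert_twice[of i w "\<lambda>x y. of_bool (R x y)" 0 "Suc n" 0] i len
    unfolding num_gaps_def gap_def letter_def len' by simp
  with new show ?thesis by simp
qed

section \<open>Moments\<close>

abbreviation stirling_expectation :: "nat \<Rightarrow> (nat list \<Rightarrow> real) \<Rightarrow> real" where
  "stirling_expectation n \<equiv> measure_pmf.expectation (random_stirling n)"

text \<open>Over all insertion gaps the indicators of destroyed gaps add up to
  \<open>num_gaps R w\<close> itself, which makes the recurrence linear.\<close>

lemma expectation_num_gaps_Suc:
  assumes "one_new_gap R"
  shows "stirling_expectation (Suc n) (num_gaps R)
    = (2 * real n * stirling_expectation n (num_gaps R) + (2 * real n + 1)) / (2 * real n + 1)"
proof -
  have "stirling_expectation n (\<lambda>w. \<Sum>i\<le>2 * n. num_gaps R (insert_twice (Suc n) i w))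
      = stirling_expectation n (\<lambda>w. 2 * real n * num_gaps R w + (2 * real n + 1))"
  proof (rule expectation_random_stirling_cong)
    fix w assume w: "w \<in> stirling_permutations n"
    have "(\<Sum>i\<le>2 * n. num_gaps R (insert_twice (Suc n) i w))
        = (\<Sum>i\<le>2 * n. num_gaps R w + 1 - gap R w i)"
      using assms w by (intro sum.cong) (simp_all add: num_gaps_insert_twice)
    also have "\<dots> = (2 * real n + 1) * (num_gaps R w + 1) - num_gaps R w"
      using length_stirling_permutation[OF w] by (simp add: sum_subtractf num_gaps_def)
    finally show "(\<Sum>i\<le>2 * n. num_gaps R (insert_twice (Suc n) i w))
        = 2 * real n * num_gaps R w + (2 * real n + 1)"
      by (simp add: algebra_simps)
  qed
  then show ?thesis by (simp add: expectation_random_stirling_Suc)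
qed

lemma expectation_num_gaps:
  assumes "one_new_gap R" "n \<ge> 1"
  shows "stirling_expectation n (num_gaps R) = (2 * real n + 1) / 3"
  using assms(2)
proof (induction n rule: dec_induct)
  case base
  \<comment> \<open>The means differ between the statistics at n = 0, where the only gap is a
    plateau, but the factor 2n removes them from the recurrence.\<close>
  show ?case using expectation_num_gaps_Suc[OF assms(1), of 0] by simp
next
  case (step n)
  then show ?case
    by (simp add: expectation_num_gaps_Suc[OF assms(1)] field_simps)
qed

text \<open>One destroyed gap cannot count for both relations, so the product of the two indicators
  vanishes. The two remaining cross terms each remove one copy of the product of the counts, turning
  the coefficient 2n + 1 into 2n - 1.\<close>

lemma expectation_num_gaps_mult_Suc:
  assumes R: "one_new_gap R" and S: "one_new_gap S" and disj: "\<And>a b. \<not> (R a b \<and> S a b)"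
  shows "stirling_expectation (Suc n) (\<lambda>w. num_gaps R w * num_gaps S w)
    = ((2 * real n - 1) * stirling_expectation n (\<lambda>w. num_gaps R w * num_gaps S w)
       + 2 * real n * (stirling_expectation n (num_gaps R) + stirling_expectation n (num_gaps S))
       + (2 * real n + 1)) / (2 * real n + 1)"
proof -
  have "stirling_expectation n (\<lambda>w. \<Sum>i\<le>2 * n.
          num_gaps R (insert_twice (Suc n) i w) * num_gaps S (insert_twice (Suc n) i w))
      = stirling_expectation n (\<lambda>w. (2 * real n - 1) * (num_gaps R w * num_gaps S w)
          + 2 * real n * (num_gaps R w + num_gaps S w) + (2 * real n + 1))"
  proof (rule expectation_random_stirling_cong)
    fix w assume w: "w \<in> stirling_permutations n"
    let ?x = "num_gaps R w" and ?y = "num_gaps S w"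
    have prod0: "gap R w i * gap S w i = 0" for i
      using disj by (auto simp: gap_def)
    have "(\<Sum>i\<le>2 * n. num_gaps R (insert_twice (Suc n) i w) * num_gaps S (insert_twice (Suc n) i w))
        = (\<Sum>i\<le>2 * n. (?x + 1) * (?y + 1) - (?x + 1) * gap S w i - (?y + 1) * gap R w i)"
    proof (intro sum.cong refl)
      fix i assume "i \<in> {..2 * n}"
      then have "num_gaps R (insert_twice (Suc n) i w) * num_gaps S (insert_twice (Suc n) i w)
          = (?x + 1 - gap R w i) * (?y + 1 - gap S w i)"
        using R S w by (simp add: num_gaps_insert_twice)
      also have "\<dots> = (?x + 1) * (?y + 1) - (?x + 1) * gap S w i - (?y + 1) * gap R w i
          + gap R w i * gap S w i"
        by (simp add: algebra_simps)
      finally show "num_gaps R (insert_twice (Suc n) i w) * num_gaps S (insert_twice (Suc n) i w)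
          = (?x + 1) * (?y + 1) - (?x + 1) * gap S w i - (?y + 1) * gap R w i"
        by (simp only: prod0 add_0_right)
    qed
    also have "\<dots> = (2 * real n + 1) * ((?x + 1) * (?y + 1)) - (?x + 1) * ?y - (?y + 1) * ?x"
      using length_stirling_permutation[OF w]
      by (simp add: sum_subtractf num_gaps_def flip: sum_distrib_left)
    finally show "(\<Sum>i\<le>2 * n. num_gaps R (insert_twice (Suc n) i w) * num_gaps S (insert_twice (Suc n) i w))
        = (2 * real n - 1) * (?x * ?y) + 2 * real n * (?x + ?y) + (2 * real n + 1)"
      by (simp add: algebra_simps)
  qed
  then show ?thesis by (simp add: expectation_random_stirling_Suc)
qed

text \<open>The closed form is the product of the two means plus the claimed covariance.\<close>

lemma expectation_num_gaps_mult:
  assumes R: "one_new_gap R" and S: "one_new_gap S" and disj: "\<And>a b. \<not> (R a b \<and> S a b)"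
    and "n \<ge> 1"
  shows "stirling_expectation n (\<lambda>w. num_gaps R w * num_gaps S w)
    = (2 * real n + 1)\<^sup>2 / 9 - ((real n)\<^sup>2 - 1) / (9 * (2 * real n - 1))"
  using \<open>n \<ge> 1\<close>
proof (induction n rule: dec_induct)
  case base
  have "stirling_permutations 0 = {[]}"
    by (auto simp: stirling_permutations_def permutations_of_multiset_def)
  \<comment> \<open>Here the recurrence at n = 0 has coefficient -1, so the initial moment matters.
    The empty word has the single gap (0, 0), which cannot satisfy both relations.\<close>
  then have "stirling_expectation 0 (\<lambda>w. num_gaps R w * num_gaps S w) = 0"
    using disj[of 0 0] by (simp add: expectation_random_stirling num_gaps_def gap_def letter_def)
  then show ?case
    using expectation_num_gaps_mult_Suc[OF R S disj, of 0] by simp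
next
  case (step n)
  \<comment> \<open>In terms of \<open>m\<close> the denominators are multiples of \<open>m\<close>
    and \<open>m + 2\<close>, both positive; clearing them leaves a polynomial identity.\<close>
  define m where "m = 2 * real n - 1"
  have m: "m > 0" using step.hyps by (simp add: m_def)
  have n: "2 * real n = m + 1" "2 * real n - 1 = m" "2 * real n + 1 = m + 2" "real n = (m + 1) / 2"
    by (simp_all add: m_def)
  have Suc_n: "2 * real (Suc n) + 1 = m + 4" "2 * real (Suc n) - 1 = m + 2" "real (Suc n) = (m + 3) / 2"
    by (simp_all add: m_def)
  have mean: "stirling_expectation n (num_gaps R) = (m + 2) / 3"
    "stirling_expectation n (num_gaps S) = (m + 2) / 3"
    using step.hyps expectation_num_gaps[OF R, of n] expectation_num_gaps[OF S, of n]
    unfolding n(3) by simp_all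
  have "stirling_expectation (Suc n) (\<lambda>w. num_gaps R w * num_gaps S w)
    = (m * ((m + 2)\<^sup>2 / 9 - (((m + 1) / 2)\<^sup>2 - 1) / (9 * m))
       + (m + 1) * ((m + 2) / 3 + (m + 2) / 3) + (m + 2)) / (m + 2)"
    unfolding expectation_num_gaps_mult_Suc[OF R S disj] step.IH mean unfolding n(2,3)
    unfolding n(1) by (simp only: n(4))
  also have "\<dots> = (m + 4)\<^sup>2 / 9 - (((m + 3) / 2)\<^sup>2 - 1) / (9 * (m + 2))"
    using m by (simp add: divide_simps) (simp add: algebra_simps power2_eq_square)
  finally show ?case unfolding Suc_n(1,2) unfolding Suc_n(3) .
qed

text \<open>Both means equal \<open>?\<mu>\<close>, so subtracting its square from the mixed moment
  leaves only the second term of the closed form.\<close>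

lemma covariance_num_gaps:
  assumes "one_new_gap R" "one_new_gap S" "\<And>a b. \<not> (R a b \<and> S a b)" "n \<ge> 1"
  shows "covariance (random_stirling n) (num_gaps R) (num_gaps S)
    = - (((real n)\<^sup>2 - 1) / (9 * (2 * real n - 1)))"
proof -
  let ?\<mu> = "(2 * real n + 1) / 3"
  have "covariance (random_stirling n) (num_gaps R) (num_gaps S)
      = stirling_expectation n (\<lambda>w. (num_gaps R w - ?\<mu>) * (num_gaps S w - ?\<mu>))"
    unfolding covariance_def using assms by (simp add: expectation_num_gaps)
  also have "\<dots> = stirling_expectation n
      (\<lambda>w. num_gaps R w * num_gaps S w - ?\<mu> * num_gaps R w - ?\<mu> * num_gaps S w + ?\<mu> * ?\<mu>)"
    by (simp add: algebra_simps)
  also have "\<dots> = stirling_expectation n (\<lambda>w. num_gaps R w * num_gaps S w)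
      - ?\<mu> * stirling_expectation n (num_gaps R) - ?\<mu> * stirling_expectation n (num_gaps S) + ?\<mu> * ?\<mu>"
    by simp
  also have "\<dots> = stirling_expectation n (\<lambda>w. num_gaps R w * num_gaps S w) - ?\<mu>\<^sup>2"
    using assms by (simp add: expectation_num_gaps power2_eq_square)
  also have "\<dots> = - (((real n)\<^sup>2 - 1) / (9 * (2 * real n - 1)))"
    by (simp add: expectation_num_gaps_mult[OF assms] power_divide)
  finally show ?thesis .
qed

theorem theorem2p4:
  fixes n :: nat
  assumes "n \<ge> 1"
  shows "covariance (random_stirling n) num_ascents num_descents
           = - (((real n)\<^sup>2 - 1) / (9 * (2 * real n - 1)))
       \<and> covariance (random_stirling n) num_ascents num_plateaux
           = - (((real n)\<^sup>2 - 1) / (9 * (2 * real n - 1)))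
       \<and> covariance (random_stirling n) num_descents num_plateaux
           = - (((real n)\<^sup>2 - 1) / (9 * (2 * real n - 1)))"
  \<comment> \<open>The implicit coercions to \<open>real\<close> turn the counts into
    \<open>num_gaps\<close>; \<open>auto\<close> then checks that the three relations are pairwise
    disjoint.\<close>
  unfolding num_ascents_eq num_descents_eq num_plateaux_eq
  using assms by (intro conjI covariance_num_gaps one_new_gap_simps) auto

end
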